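(* Let $L$ be a finite loop and let $k\geq 2$ be an integer. Then $$\mathcal{B}^k(L,\mathbb{Z}_2)\trianglelefteq \mathcal{Z}_{\mathcal{L}}^k(L,\mathbb{Z}_2)\qquad\text{and}\qquad \mathcal{Z}^k(L,\mathbb{Z}_2)\trianglelefteq \mathcal{Z}_{\mathcal{L}}^k(L,\mathbb{Z}_2),$$ i.e. both the group of $k$-coboundaries and the group of $k$-cocycles are (normal) subgroups of the group of $k$-loop-cocycles.
   Context: A loop is a finite set $L$ with a binary operation having an identity element $e$ and such that for all $a,b\in L$ the equations $ax=b$ and $ya=b$ have unique solutions $x,y\in L$. Let $\mathbb{Z}_2=(\mathbb{F}_2,+)$ and let $\mathcal{C}^k(L,\mathbb{Z}_2)$ be the abelian group of all functions ($k$-cochains) $L^k\to\mathbb{Z}_2$ under pointwise addition. The coboundary operator $\delta:\mathcal{C}^k(L,\mathbb{Z}_2)\to\mathcal{C}^{k+1}(L,\mathbb{Z}_2)$, $f\mapsto\delta_f$, is $$\delta_f(a_1,\ldots,a_{k+1})=f(a_1,\ldots,a_k)+f(a_2,\ldots,a_{k+1})+\sum_{i=1}^k f(a_1,\ldots,a_ia_{i+1},\ldots,a_{k+1}).$$ Write $\delta^2(f)=\delta(\delta_f)$. (For non-associative $L$, $\delta^2$ need not vanish.) Put - $\mathcal{B}^k(L,\mathbb{Z}_2)=\{\delta_f: f\in\mathcal{C}^{k-1}(L,\mathbb{Z}_2)\}$ ($k$-coboundaries), - $\mathcal{Z}^k(L,\mathbb{Z}_2)=\{\psi\in\mathcal{C}^k(L,\mathbb{Z}_2):\delta_\psi=0\}$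 ($k$-cocycles), - $\mathcal{Z}^k_{\mathcal{L}}(L,\mathbb{Z}_2)=\{\psi\in\mathcal{C}^k(L,\mathbb{Z}_2):\delta_\psi\in\mathrm{Im}(\delta^2)\}$ ($k$-loop-cocycles), where $\mathrm{Im}(\delta^2)=\{\delta^2(f): f\in\mathcal{C}^{k-1}(L,\mathbb{Z}_2)\}$. *)

theory Defs
  imports "HOL-Algebra.Product_Groups" "HOL-Algebra.Coset" "HOL-Library.Z2"
begin

locale loop =
  fixes L :: "('a, 'm) monoid_scheme" (structure)
  assumes m_closed: "\<lbrakk>a \<in> carrier L; b \<in> carrier L\<rbrakk> \<Longrightarrow> a \<otimes> b \<in> carrier L"
    and one_closed: "\<one> \<in> carrier L"
    and l_one: "a \<in> carrier L \<Longrightarrow> \<one> \<otimes> a = a"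
    and r_one: "a \<in> carrier L \<Longrightarrow> a \<otimes> \<one> = a"
    and ex1_right_solution:
      "\<lbrakk>a \<in> carrier L; b \<in> carrier L\<rbrakk> \<Longrightarrow> \<exists>!x. x \<in> carrier L \<and> a \<otimes> x = b"
    and ex1_left_solution:
      "\<lbrakk>a \<in> carrier L; b \<in> carrier L\<rbrakk> \<Longrightarrow> \<exists>!y. y \<in> carrier L \<and> y \<otimes> a = b"

definition Z2_group :: "bit monoid" where
  "Z2_group = \<lparr>carrier = UNIV, mult = (+), one = 0\<rparr>"

definition tuples :: "('a, 'm) monoid_scheme \<Rightarrow> nat \<Rightarrow> 'a list set" where
  "tuples L k = {as. set as \<subseteq> carrier L \<and> length as = k}"

text \<open>Cochains are extensional functions: they are \<^const>\<open>undefined\<close> outside the tuples of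
  the right length, so that equality of cochains is equality of functions.\<close>

definition cochains :: "('a, 'm) monoid_scheme \<Rightarrow> nat \<Rightarrow> ('a list \<Rightarrow> bit) monoid" where
  "cochains L k = product_group (tuples L k) (\<lambda>_. Z2_group)"

text \<open>The argument \<open>k\<close> is the degree of the cochain \<open>f\<close>. List positions are counted from \<open>0\<close>, so the
  \<open>i\<close>-th summand multiplies the entries usually numbered \<open>i + 1\<close> and \<open>i + 2\<close>.\<close>

definition coboundary ::
    "('a, 'm) monoid_scheme \<Rightarrow> nat \<Rightarrow> ('a list \<Rightarrow> bit) \<Rightarrow> 'a list \<Rightarrow> bit" where
  "coboundary L k f = (\<lambda>as\<in>tuples L (k + 1).
     f (take k as) + f (drop 1 as) +
     (\<Sum>i<k. f (take i as @ [(as ! i) \<otimes>\<^bsub>L\<^esub> (as ! (i + 1))] @ drop (i + 2) as)))"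

text \<open>The sets below are meant for \<open>k \<ge> 1\<close>, where \<open>k - 1\<close> is not truncated.\<close>

definition coboundaries :: "('a, 'm) monoid_scheme \<Rightarrow> nat \<Rightarrow> ('a list \<Rightarrow> bit) set" where
  "coboundaries L k = coboundary L (k - 1) ` carrier (cochains L (k - 1))"

definition cocycles :: "('a, 'm) monoid_scheme \<Rightarrow> nat \<Rightarrow> ('a list \<Rightarrow> bit) set" where
  "cocycles L k =
     {\<psi> \<in> carrier (cochains L k). coboundary L k \<psi> = \<one>\<^bsub>cochains L (k + 1)\<^esub>}"

definition loop_cocycles :: "('a, 'm) monoid_scheme \<Rightarrow> nat \<Rightarrow> ('a list \<Rightarrow> bit) set" where
  "loop_cocycles L k =
     {\<psi> \<in> carrier (cochains L k).
        coboundary L k \<psi> \<in>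
          (\<lambda>f. coboundary L k (coboundary L (k - 1) f)) ` carrier (cochains L (k - 1))}"

definition loop_cocycle_group ::
    "('a, 'm) monoid_scheme \<Rightarrow> nat \<Rightarrow> ('a list \<Rightarrow> bit) monoid" where
  "loop_cocycle_group L k = (cochains L k)\<lparr>carrier := loop_cocycles L k\<rparr>"

end

theory Submission
  imports Defs
begin

text \<open>The coboundary operator is a homomorphism of abelian groups, so coboundaries form the image of
  a homomorphism, cocycles form a kernel, and loop-cocycles form the preimage of a subgroup, which
  contains the other two.\<close>

lemma Z2_group_simps [simp]:
  "carrier Z2_group = UNIV" "x \<otimes>\<^bsub>Z2_group\<^esub> y = x + y" "\<one>\<^bsub>Z2_group\<^esub> = 0"
  by (simp_all add: Z2_group_def)

lemma comm_group_Z2_group: "comm_group Z2_group"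
  by (rule comm_groupI) (auto simp: add.assoc add.commute intro: exI[of _ "- x" for x])

lemma comm_group_cochains: "comm_group (cochains L k)"
proof (rule group.group_comm_groupI)
  show "group (cochains L k)"
    by (simp add: cochains_def comm_group.axioms(2)[OF comm_group_Z2_group])
qed (simp only: cochains_def mult_product_group Z2_group_simps add.commute)

text \<open>Every bit is an admissible value, so extensionality is the only condition left on a
  cochain.\<close>

lemma carrier_cochains: "carrier (cochains L k) = extensional (tuples L k)"
  by (simp add: cochains_def PiE_def)

lemma mult_cochains: "f \<otimes>\<^bsub>cochains L k\<^esub> g = (\<lambda>as\<in>tuples L k. f as + g as)"
  by (simp add: cochains_def)

text \<open>Needed because a sum of cochains is the pointwise sum only on tuples of the right
  length; the arguments in \<open>coboundary\<close> must be shown to be such tuples.\<close>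

lemma merge_in_tuples:
  assumes "loop L" "as \<in> tuples L (k + 1)" "i < k"
  shows "take i as @ [(as ! i) \<otimes>\<^bsub>L\<^esub> (as ! (i + 1))] @ drop (i + 2) as \<in> tuples L k"
proof -
  have as: "set as \<subseteq> carrier L" "length as = k + 1"
    using assms(2) by (auto simp: tuples_def)
  then have "as ! i \<in> carrier L" "as ! (i + 1) \<in> carrier L"
    using assms(3) nth_mem[of i as] nth_mem[of "i + 1" as] by auto
  then have "(as ! i) \<otimes>\<^bsub>L\<^esub> (as ! (i + 1)) \<in> carrier L"
    using assms(1) by (rule loop.m_closed[rotated])
  then show ?thesis
    using as assms(3) set_take_subset[of i as] set_drop_subset[of "i + 2" as]
    by (auto simp: tuples_def)
qed

text \<open>The value of the coboundary at a tuple is a sum of values of the cochain at faces of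
  that tuple, and each evaluation is additive in the cochain.\<close>

lemma coboundary_hom:
  assumes "loop L"
  shows "coboundary L k \<in> hom (cochains L k) (cochains L (k + 1))"
proof (rule homI)
  fix f g
  show "coboundary L k f \<in> carrier (cochains L (k + 1))"
    by (simp add: coboundary_def carrier_cochains)
  show "coboundary L k (f \<otimes>\<^bsub>cochains L k\<^esub> g) =
      coboundary L k f \<otimes>\<^bsub>cochains L (k + 1)\<^esub> coboundary L k g"
    unfolding mult_cochains
  \<comment> \<open>Only the coboundary of the sum is unfolded; both sides are then restrictions to
    the same tuples and are compared pointwise.\<close>
  proof (subst coboundary_def, rule restrict_ext)
    fix as assume as: "as \<in> tuples L (k + 1)"
    let ?m = "\<lambda>i. take i as @ [(as ! i) \<otimes>\<^bsub>L\<^esub> (as ! (i + 1))] @ drop (i + 2) as"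
    let ?fg = "\<lambda>as\<in>tuples L k. f as + g as"
    have "take k as \<in> tuples L k" "drop 1 as \<in> tuples L k"
      using as set_take_subset[of k as] set_drop_subset[of 1 as] by (auto simp: tuples_def)
    then have faces: "?fg (take k as) = f (take k as) + g (take k as)"
        "?fg (drop 1 as) = f (drop 1 as) + g (drop 1 as)"
      by (simp_all only: restrict_apply if_True)
    have sums: "(\<Sum>i<k. ?fg (?m i)) = (\<Sum>i<k. f (?m i)) + (\<Sum>i<k. g (?m i))"
      unfolding sum.distrib[symmetric]
      by (intro sum.cong refl restrict_apply' merge_in_tuples[OF assms as]) (simp only: lessThan_iff)
    have "coboundary L k h as = h (take k as) + h (drop 1 as) + (\<Sum>i<k. h (?m i))" for h
      using as by (simp only: coboundary_def restrict_apply if_True)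
    then show "?fg (take k as) + ?fg (drop 1 as) + (\<Sum>i<k. ?fg (?m i)) =
        coboundary L k f as + coboundary L k g as"
      by (simp only: faces sums ac_simps)
  qed
qed

lemma coboundary_group_hom:
  assumes "loop L"
  shows "group_hom (cochains L k) (cochains L (k + 1)) (coboundary L k)"
  by (intro group_hom.intro group_hom_axioms.intro coboundary_hom[OF assms]
      comm_group_cochains[THEN comm_group.axioms(2)])

text \<open>Applied below with \<open>h\<close> the coboundary in degree \<open>k\<close> and
  \<open>K\<close> the image of the squared coboundary.\<close>

lemma (in group_hom) subgroup_preimage:
  assumes "subgroup K H"
  shows "subgroup {x \<in> carrier G. h x \<in> K} G"
proof -
  interpret K: subgroup K H by (rule assms)
  show ?thesis
    by (rule G.subgroupI) (auto intro: exI[of _ "\<one>\<^bsub>G\<^esub>"])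
qed

text \<open>In an abelian group every subgroup is normal, and normality passes to any intermediate
  subgroup.\<close>

lemma (in comm_group) normal_subgroup_restrict:
  assumes "subgroup K G" "subgroup N G" "N \<subseteq> K"
  shows "N \<lhd> G\<lparr>carrier := K\<rparr>"
  using assms by (intro normal_restrict_supergroup subgroup_imp_normal)

theorem lemma2p2:
  fixes L :: "('a, 'm) monoid_scheme" and k :: nat
  assumes "loop L" and "finite (carrier L)" and "k \<ge> 2"
  shows "coboundaries L k \<lhd> loop_cocycle_group L k \<and>
         cocycles L k \<lhd> loop_cocycle_group L k"
proof -
  interpret C: comm_group "cochains L k" by (rule comm_group_cochains)
  \<comment> \<open>Subtraction on \<open>nat\<close> is not truncated here, so the coboundary from
    degree \<open>k - 1\<close> lands in degree \<open>k\<close>.\<close>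
  have "k - 1 + 1 = k" using assms(3) by simp
  with coboundary_group_hom[OF assms(1), of "k - 1"]
  interpret d1: group_hom "cochains L (k - 1)" "cochains L k" "coboundary L (k - 1)" by simp
  interpret d2: group_hom "cochains L k" "cochains L (k + 1)" "coboundary L k"
    by (rule coboundary_group_hom[OF assms(1)])
  have B: "subgroup (coboundaries L k) (cochains L k)"
    unfolding coboundaries_def by (rule d1.img_is_subgroup)
  have Z: "subgroup (cocycles L k) (cochains L k)"
    using d2.subgroup_kernel by (simp add: cocycles_def kernel_def)
  \<comment> \<open>The image of the squared coboundary is the coboundary image of
    \<open>coboundaries L k\<close>, which exhibits the loop-cocycles as a preimage.\<close>
  have ZL: "loop_cocycles L k =
      {\<psi> \<in> carrier (cochains L k). coboundary L k \<psi> \<in> coboundary L k ` coboundaries L k}"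
    by (simp add: loop_cocycles_def coboundaries_def image_image)
  have im: "subgroup (coboundary L k ` coboundaries L k) (cochains L (k + 1))"
    by (rule d2.subgroup_img_is_subgroup[OF B])
  have "coboundaries L k \<subseteq> loop_cocycles L k"
    using subgroup.subset[OF B] by (auto simp: ZL)
  \<comment> \<open>A cocycle has coboundary zero, and zero lies in the subgroup
    \<open>im\<close>.\<close>
  moreover have "cocycles L k \<subseteq> loop_cocycles L k"
    using subgroup.one_closed[OF im] by (auto simp: ZL cocycles_def)
  moreover have "subgroup (loop_cocycles L k) (cochains L k)"
    unfolding ZL by (rule d2.subgroup_preimage[OF im])
  ultimately show ?thesis
    using B Z by (simp add: loop_cocycle_group_def C.normal_subgroup_restrict)
qed

end
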